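(* Let $G$ be a finite $d$-regular simple graph that admits a FAT $k$-coloring with parameter $\alpha$. Then $dk\alpha$ is an eigenvalue of the Kirchhoff Laplacian $K(G)$ with multiplicity at least $\max\{1,k-1\}$, and $d(1-k\alpha)$ is an eigenvalue of the adjacency matrix $A(G)$ with multiplicity at least $\max\{1,k-1\}$.
   Context: For $v\in V$ and $S\subseteq V$, let $e(v,S)$ denote the number of neighbors of $v$ in $S$. A vertex $k$-coloring of $G$ is a function $c:V\to\{1,\ldots,k\}$ with coloring classes $V_i=c^{-1}(i)$. It is Fair and Tolerant (FAT) with parameter $\alpha\in[0,1]$ if, with $\beta:=1-(k-1)\alpha$, for every vertex $v$ and every $i$ we have $e(v,V_i)=\alpha\deg v$ if $v\notin V_i$ and $e(v,V_i)=\beta\deg v$ if $v\in V_i$. $A(G)$ is the adjacency matrix, $D$ the diagonal degree matrix, and $K(G)=D-A$ the Kirchhoff Laplacian.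
   Formalization: Two conditions are added, without which the claim fails: every coloring class is nonempty (K_2, k=4, α=0, one color used is a counterexample), and α=0 when k=1 (there α is otherwise unconstrained; K_2 with α=1/2 fails). *)

theory Defs
  imports "HOL-Analysis.Analysis"
begin

text \<open>A finite graph is given by its adjacency relation on a finite vertex type \<open>'v\<close>
  (nonempty, as every type is).\<close>

definition simple_graph :: "('v::finite \<Rightarrow> 'v \<Rightarrow> bool) \<Rightarrow> bool" where
  "simple_graph E \<longleftrightarrow> symp E \<and> irreflp E"

definition nbr_count :: "('v::finite \<Rightarrow> 'v \<Rightarrow> bool) \<Rightarrow> 'v \<Rightarrow> 'v set \<Rightarrow> nat" where
  "nbr_count E v S = card {w \<in> S. E v w}"

definition degree :: "('v::finite \<Rightarrow> 'v \<Rightarrow> bool) \<Rightarrow> 'v \<Rightarrow> nat" where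
  "degree E v = card {w. E v w}"

definition regular :: "('v::finite \<Rightarrow> 'v \<Rightarrow> bool) \<Rightarrow> nat \<Rightarrow> bool" where
  "regular E d \<longleftrightarrow> (\<forall>v. degree E v = d)"

definition coloring :: "nat \<Rightarrow> ('v::finite \<Rightarrow> nat) \<Rightarrow> bool" where
  "coloring k c \<longleftrightarrow> (\<forall>v. c v \<in> {1..k})"

definition color_class :: "('v::finite \<Rightarrow> nat) \<Rightarrow> nat \<Rightarrow> 'v set" where
  "color_class c i = c -` {i}"

definition fat_coloring ::
  "('v::finite \<Rightarrow> 'v \<Rightarrow> bool) \<Rightarrow> nat \<Rightarrow> real \<Rightarrow> ('v \<Rightarrow> nat) \<Rightarrow> bool" where
  "fat_coloring E k \<alpha> c \<longleftrightarrow>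
     coloring k c \<and> \<alpha> \<in> {0..1} \<and>
     (let \<beta> = 1 - (real k - 1) * \<alpha> in
      \<forall>v. \<forall>i\<in>{1..k}.
        (v \<notin> color_class c i \<longrightarrow>
           real (nbr_count E v (color_class c i)) = \<alpha> * real (degree E v)) \<and>
        (v \<in> color_class c i \<longrightarrow>
           real (nbr_count E v (color_class c i)) = \<beta> * real (degree E v)))"

definition adjacency_matrix :: "('v::finite \<Rightarrow> 'v \<Rightarrow> bool) \<Rightarrow> real ^ 'v ^ 'v" where
  "adjacency_matrix E = (\<chi> v w. if E v w then 1 else 0)"

definition degree_matrix :: "('v::finite \<Rightarrow> 'v \<Rightarrow> bool) \<Rightarrow> real ^ 'v ^ 'v" where
  "degree_matrix E = (\<chi> v w. if v = w then real (degree E v) else 0)"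

definition kirchhoff_laplacian :: "('v::finite \<Rightarrow> 'v \<Rightarrow> bool) \<Rightarrow> real ^ 'v ^ 'v" where
  "kirchhoff_laplacian E = degree_matrix E - adjacency_matrix E"

definition is_eigenvalue :: "real ^ 'v ^ 'v \<Rightarrow> real \<Rightarrow> bool" where
  "is_eigenvalue M l \<longleftrightarrow> (\<exists>x. x \<noteq> 0 \<and> M *v x = l *\<^sub>R x)"

text \<open>Geometric multiplicity. It never exceeds the algebraic one, so lower bounds carry over;
  for the symmetric matrices considered here the two coincide.\<close>

definition eigenvalue_mult :: "real ^ 'v ^ 'v \<Rightarrow> real \<Rightarrow> nat" where
  "eigenvalue_mult M l = dim {x. M *v x = l *\<^sub>R x}"

end

theory Submission
  imports Defs
begin

text \<open>The indicator \<open>\<chi>\<^sub>i\<close> of the \<open>i\<close>-th colour class satisfies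
  \<open>A \<chi>\<^sub>i = d\<alpha> \<one> + d(1 - k\<alpha>) \<chi>\<^sub>i\<close>, because \<open>\<beta> - \<alpha> = 1 - k\<alpha>\<close>. Hence the differences
  \<open>\<chi>\<^sub>i - \<chi>\<^sub>1\<close>, \<open>2 \<le> i \<le> k\<close>, are eigenvectors of \<open>A\<close> for \<open>d(1 - k\<alpha>)\<close>, and they are linearly
  independent since no class is empty. For \<open>k = 1\<close> the constant vector is an eigenvector.
  By regularity \<open>K = d I - A\<close>, so the two matrices share their eigenspaces.\<close>

text \<open>Reading the entry at \<open>p j\<close> is a functional dual to the family
  \<open>f\<close>, so it isolates a single coefficient of any vanishing combination; this forces
  independence.\<close>

lemma card_le_dim_of_dual_coordinates:
  fixes f :: "'i \<Rightarrow> real ^ 'n"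
  assumes "finite I"
    and dual: "\<And>i j. i \<in> I \<Longrightarrow> j \<in> I \<Longrightarrow> f i $ p j = (if i = j then 1 else 0)"
    and "f ` I \<subseteq> S"
  shows "card I \<le> dim S"
proof -
  have inj: "inj_on f I"
    by (rule inj_onI) (metis dual zero_neq_one)
  have "independent (f ` I)"
  proof (rule independent_if_scalars_zero)
    fix u x
    assume zero: "(\<Sum>y\<in>f ` I. u y *\<^sub>R y) = 0" and "x \<in> f ` I"
    then obtain j where j: "j \<in> I" "x = f j" by blast
    have "0 = (\<Sum>i\<in>I. u (f i) *\<^sub>R f i) $ p j"
      using zero by (simp add: sum.reindex[OF inj])
    also have "\<dots> = (\<Sum>i\<in>I. if i = j then u (f i) else 0)"
      unfolding sum_component by (rule sum.cong) (auto simp: dual j)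
    also have "\<dots> = u x"
      using j \<open>finite I\<close> by simp
    finally show "u x = 0" by simp
  qed (use \<open>finite I\<close> in simp)
  then have "card (f ` I) \<le> dim S"
    using \<open>f ` I \<subseteq> S\<close> independent_card_le_dim by blast
  then show ?thesis
    by (simp add: card_image[OF inj])
qed

lemma is_eigenvalue_if_eigenvalue_mult_pos:
  fixes M :: "real ^ 'v ^ 'v"
  assumes "eigenvalue_mult M l \<ge> 1"
  shows "is_eigenvalue M l"
proof (rule ccontr)
  assume "\<not> is_eigenvalue M l"
  then have "{x. M *v x = l *\<^sub>R x} \<subseteq> {0}"
    by (auto simp: is_eigenvalue_def)
  then have "eigenvalue_mult M l = 0"
    by (simp add: eigenvalue_mult_def dim_eq_0)
  with assms show False by simp
qed

lemma kirchhoff_laplacian_eigenvector_iff: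
  fixes E :: "'v::finite \<Rightarrow> 'v \<Rightarrow> bool"
  assumes "regular E d"
  shows "kirchhoff_laplacian E *v x = (real d - l) *\<^sub>R x \<longleftrightarrow> adjacency_matrix E *v x = l *\<^sub>R x"
proof -
  have "degree_matrix E *v x = real d *\<^sub>R x"
    using assms
    by (simp add: vec_eq_iff degree_matrix_def regular_def matrix_vector_mult_def
        if_distrib[where f = "\<lambda>a. a * _"] cong: if_cong)
  then have "kirchhoff_laplacian E *v x = real d *\<^sub>R x - adjacency_matrix E *v x"
    by (simp add: kirchhoff_laplacian_def matrix_vector_mult_diff_rdistrib)
  then show ?thesis
    by (auto simp: scaleR_left_diff_distrib)
qed

definition indicator_vec :: "'v::finite set \<Rightarrow> real ^ 'v" where
  "indicator_vec S = (\<chi> v. indicator S v)"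

lemma adjacency_matrix_indicator_vec:
  "(adjacency_matrix E *v indicator_vec S) $ v = real (nbr_count E v S)"
proof -
  have "(adjacency_matrix E *v indicator_vec S) $ v = (\<Sum>w\<in>UNIV. if w \<in> S \<and> E v w then 1 else 0)"
    unfolding adjacency_matrix_def indicator_vec_def matrix_vector_mult_def vec_lambda_beta
    by (rule sum.cong) (auto simp: indicator_def)
  also have "\<dots> = real (nbr_count E v S)"
    by (simp add: nbr_count_def sum.If_cases)
  finally show ?thesis .
qed

lemma adjacency_matrix_color_class:
  fixes E :: "'v::finite \<Rightarrow> 'v \<Rightarrow> bool"
  assumes "regular E d" "fat_coloring E k \<alpha> c" "i \<in> {1..k}"
  shows "adjacency_matrix E *v indicator_vec (color_class c i) =
    (real d * \<alpha>) *\<^sub>R 1 + (real d * (1 - real k * \<alpha>)) *\<^sub>R indicator_vec (color_class c i)"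
proof -
  let ?S = "color_class c i"
  have deg: "degree E v = d" for v
    using assms(1) by (simp add: regular_def)
  \<comment> \<open>One formula covers both FAT cases: the base value d\<alpha> off the class, plus
    the jump d(\<beta> - \<alpha>) on it.\<close>
  have "real (nbr_count E v ?S) = real d * \<alpha> + real d * (1 - real k * \<alpha>) * indicator ?S v" for v
  proof (cases "v \<in> ?S")
    case True
    then have "real (nbr_count E v ?S) = (1 - (real k - 1) * \<alpha>) * real d"
      using assms(2,3) unfolding fat_coloring_def Let_def deg by blast
    with True show ?thesis by (simp add: algebra_simps)
  next
    case False
    then have "real (nbr_count E v ?S) = \<alpha> * real d"
      using assms(2,3) unfolding fat_coloring_def Let_def deg by blast
    with False show ?thesis by simp
  qed
  then show ?thesis
    by (simp add: vec_eq_iff adjacency_matrix_indicator_vec) (simp add: indicator_vec_def)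
qed

text \<open>Nonempty classes supply the vertices that separate the eigenvectors. For k = 1 we have
  \<beta> = 1 whatever \<alpha> is, so the colouring does not determine \<alpha>;
  \<open>triv\<close> makes the claimed eigenvalue equal to d.\<close>

lemma adjacency_eigenvalue_mult_ge:
  fixes E :: "'v::finite \<Rightarrow> 'v \<Rightarrow> bool"
  assumes reg: "regular E d"
    and fat: "fat_coloring E k \<alpha> c"
    and nonempty: "\<forall>i\<in>{1..k}. color_class c i \<noteq> {}"
    and triv: "k = 1 \<longrightarrow> \<alpha> = 0"
  shows "max 1 (k - 1) \<le> eigenvalue_mult (adjacency_matrix E) (real d * (1 - real k * \<alpha>))"
proof (cases "k \<le> 1")
  case True
  have range: "c v \<in> {1..k}" for v
    using fat by (simp add: fat_coloring_def coloring_def)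
  \<comment> \<open>The case k = 0 is impossible: some vertex exists, and its colour lies in
    \<open>{1..k}\<close>.\<close>
  with True have k: "k = 1"
    by (metis atLeastAtMost_iff le_antisym le_trans)
  with range have "color_class c 1 = UNIV"
    by (auto simp: color_class_def)
  then have "indicator_vec (color_class c 1) = 1"
    by (simp add: indicator_vec_def vec_eq_iff)
  then have "adjacency_matrix E *v 1 = real d *\<^sub>R 1"
    using adjacency_matrix_color_class[OF reg fat, of 1] k triv by simp
  \<comment> \<open>A one-element family; any vertex serves as \<open>p\<close>, since the constant
    vector has entry 1 everywhere.\<close>
  then have "card {0::nat} \<le> dim {x. adjacency_matrix E *v x = real d *\<^sub>R x}"
    by (intro card_le_dim_of_dual_coordinates[where f = "\<lambda>_. 1"]) auto
  then show ?thesis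
    using k triv by (simp add: eigenvalue_mult_def)
next
  case False
  define f where "f i = indicator_vec (color_class c i) - indicator_vec (color_class c 1)" for i
  have "\<forall>i\<in>{1..k}. \<exists>v. c v = i"
    using nonempty by (auto simp: color_class_def)
  \<comment> \<open>\<open>p i\<close> is a representative of class i. For j \<ge> 2 the indicator
    of class 1 vanishes at \<open>p j\<close>, so only that of class i contributes to the entry of
    \<open>f i\<close> there.\<close>
  then obtain p where p: "\<And>i. i \<in> {1..k} \<Longrightarrow> c (p i) = i"
    by metis
  have "f i $ p j = (if i = j then 1 else 0)" if "i \<in> {2..k}" "j \<in> {2..k}" for i j
    using that p[of j] by (auto simp: f_def indicator_vec_def color_class_def)
  \<comment> \<open>The constant term d\<alpha> is the same for every class and cancels in the
    difference.\<close>
  moreover have "adjacency_matrix E *v f i = (real d * (1 - real k * \<alpha>)) *\<^sub>R f i"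
    if "i \<in> {2..k}" for i
    using that
    by (simp add: f_def matrix_vector_mult_diff_distrib adjacency_matrix_color_class[OF reg fat]
        scaleR_right_diff_distrib)
  \<comment> \<open>There are k - 1 indices, and here k \<ge> 2, so the maximum is k - 1.\<close>
  ultimately have "card {2..k} \<le> eigenvalue_mult (adjacency_matrix E) (real d * (1 - real k * \<alpha>))"
    unfolding eigenvalue_mult_def
    by (intro card_le_dim_of_dual_coordinates[where f = f and p = p]) auto
  then show ?thesis
    using False by simp
qed

theorem theorem3p6:
  fixes E :: "'v::finite \<Rightarrow> 'v \<Rightarrow> bool"
    and d k :: nat and \<alpha> :: real and c :: "'v \<Rightarrow> nat"
  assumes "simple_graph E"
    and "regular E d"
    and "fat_coloring E k \<alpha> c"
    and all_colors_used: "\<forall>i\<in>{1..k}. color_class c i \<noteq> {}"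
    and trivial_coloring: "k = 1 \<longrightarrow> \<alpha> = 0"
  shows "is_eigenvalue (kirchhoff_laplacian E) (real d * real k * \<alpha>)
       \<and> eigenvalue_mult (kirchhoff_laplacian E) (real d * real k * \<alpha>) \<ge> max 1 (k - 1)
       \<and> is_eigenvalue (adjacency_matrix E) (real d * (1 - real k * \<alpha>))
       \<and> eigenvalue_mult (adjacency_matrix E) (real d * (1 - real k * \<alpha>)) \<ge> max 1 (k - 1)"
proof -
  let ?l = "real d * (1 - real k * \<alpha>)"
  have "real d * real k * \<alpha> = real d - ?l"
    by (simp add: algebra_simps)
  then have "eigenvalue_mult (kirchhoff_laplacian E) (real d * real k * \<alpha>)
      = eigenvalue_mult (adjacency_matrix E) ?l"
    unfolding eigenvalue_mult_def
    by (simp only: kirchhoff_laplacian_eigenvector_iff[OF assms(2)])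
  moreover have "max 1 (k - 1) \<le> eigenvalue_mult (adjacency_matrix E) ?l"
    using adjacency_eigenvalue_mult_ge assms by blast
  \<comment> \<open>The bound is at least 1, so both eigenspaces contain a nonzero vector.\<close>
  ultimately show ?thesis
    by (auto intro!: is_eigenvalue_if_eigenvalue_mult_pos)
qed

end
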